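(* Let $R$ be a Dedekind domain with torsion ideal class group and let $E$ be an infinite set of maximal ideals of $R$. Then the following assertions hold. (i) Let $S:=\prod_{\mathfrak{p}\in E}R/\mathfrak{p}$ and let $\pi:R\to S$, $r\mapsto(r+\mathfrak{p})_{\mathfrak{p}\in E}$, be the canonical ring map. Then $\operatorname{Im}\pi^{\ast}=E\cup\{0\}$, and for every wild prime $P$ of $S$ we have $\pi^{-1}(P)=0$. (ii) Let $S:=\prod_{\mathfrak{p}\in E}R_{\mathfrak{p}}$ and let $\pi:R\to S$, $r\mapsto(r/1)_{\mathfrak{p}\in E}$, be the canonical ring map. Then $\operatorname{Im}\pi^{\ast}=c\ell(E)=E\cup\{0\}$, and for every wild prime $P$ of $S$ we have $\pi^{-1}(P)=0$. Here $0$ denotes the zero ideal of $R$ and $c\ell(E)$ denotes the closure of $E$ in $\operatorname{Spec}(R)$ with respect to the flat topology.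
   Context: A ring map $\phi:A\to B$ induces $\phi^{\ast}:\operatorname{Spec}(B)\to\operatorname{Spec}(A)$, $\phi^{\ast}(\mathfrak{q})=\phi^{-1}(\mathfrak{q})$. The flat topology on $\operatorname{Spec}(R)$ is the topology for which the sets $V(a)=\{\mathfrak{p}\in\operatorname{Spec}(R): a\in\mathfrak{p}\}$, $a\in R$, form a sub-basis of open sets; equivalently, the sets $V(I)$ with $I$ a finitely generated ideal form a basis of open sets. For a direct product $\prod_{i\in J}A_i$ of nonzero commutative rings with projections $\pi_k:\prod_{i\in J}A_i\to A_k$, a tame prime is a prime ideal of the form $\pi_k^{-1}(\mathfrak{p})$ for some $k\in J$ and some prime ideal $\mathfrak{p}$ of $A_k$; a wild prime is a prime ideal of the product that is not tame. *)

theory Defs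
  imports "HOL-Analysis.Abstract_Topology" "HOL-Algebra.Algebra"
begin

section \<open>Prime spectrum and flat topology\<close>

definition Spec :: "('a, 'b) ring_scheme \<Rightarrow> 'a set set" where
  "Spec R = {P. primeideal P R}"

definition comap :: "('a, 'b) ring_scheme \<Rightarrow> ('a \<Rightarrow> 'c) \<Rightarrow> 'c set \<Rightarrow> 'a set" where
  "comap R f Q = {r \<in> carrier R. f r \<in> Q}"

definition flat_topology :: "('a, 'b) ring_scheme \<Rightarrow> 'a set topology" where
  "flat_topology R = topology_generated_by {{P \<in> Spec R. a \<in> P} | a. a \<in> carrier R}"


section \<open>Direct products of rings; tame and wild primes\<close>

text \<open>As for \<^const>\<open>product_group\<close>, families over \<open>J\<close> are \<^const>\<open>undefined\<close> outside \<open>J\<close>.\<close>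

definition product_ring :: "'i set \<Rightarrow> ('i \<Rightarrow> ('a, 'b) ring_scheme) \<Rightarrow> ('i \<Rightarrow> 'a) ring" where
  "product_ring J A =
    \<lparr>carrier = (\<Pi>\<^sub>E i\<in>J. carrier (A i)),
     monoid.mult = (\<lambda>x y. \<lambda>i\<in>J. x i \<otimes>\<^bsub>A i\<^esub> y i),
     one = (\<lambda>i\<in>J. \<one>\<^bsub>A i\<^esub>),
     ring.zero = (\<lambda>i\<in>J. \<zero>\<^bsub>A i\<^esub>),
     ring.add = (\<lambda>x y. \<lambda>i\<in>J. x i \<oplus>\<^bsub>A i\<^esub> y i)\<rparr>"

definition tame_prime :: "'i set \<Rightarrow> ('i \<Rightarrow> ('a, 'b) ring_scheme) \<Rightarrow> ('i \<Rightarrow> 'a) set \<Rightarrow> bool" where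
  "tame_prime J A P \<longleftrightarrow> P \<in> Spec (product_ring J A) \<and>
     (\<exists>k\<in>J. \<exists>p\<in>Spec (A k). P = comap (product_ring J A) (\<lambda>x. x k) p)"

definition wild_prime :: "'i set \<Rightarrow> ('i \<Rightarrow> ('a, 'b) ring_scheme) \<Rightarrow> ('i \<Rightarrow> 'a) set \<Rightarrow> bool" where
  "wild_prime J A P \<longleftrightarrow> P \<in> Spec (product_ring J A) \<and> \<not> tame_prime J A P"


section \<open>Localization\<close>

text \<open>
  For a multiplicative subset \<open>S\<close> of a commutative ring, the fraction \<open>a/s\<close> is represented by the
  equivalence class of the pair \<open>(a, s)\<close>. The operations on classes are given by the union over all
  representatives; as they respect the relation, this union is a single class.
\<close>

definition frac_rel :: "('a, 'b) ring_scheme \<Rightarrow> 'a set \<Rightarrow> (('a \<times> 'a) \<times> ('a \<times> 'a)) set" where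
  "frac_rel R S = {((a, s), (b, t)). a \<in> carrier R \<and> s \<in> S \<and> b \<in> carrier R \<and> t \<in> S \<and>
     (\<exists>u\<in>S. u \<otimes>\<^bsub>R\<^esub> (t \<otimes>\<^bsub>R\<^esub> a \<ominus>\<^bsub>R\<^esub> s \<otimes>\<^bsub>R\<^esub> b) = \<zero>\<^bsub>R\<^esub>)}"

definition fraction :: "('a, 'b) ring_scheme \<Rightarrow> 'a set \<Rightarrow> 'a \<Rightarrow> 'a \<Rightarrow> ('a \<times> 'a) set" where
  "fraction R S a s = frac_rel R S `` {(a, s)}"

definition localization :: "('a, 'b) ring_scheme \<Rightarrow> 'a set \<Rightarrow> ('a \<times> 'a) set ring" where
  "localization R S =
    \<lparr>carrier = (carrier R \<times> S) // frac_rel R S,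
     monoid.mult = (\<lambda>x y. \<Union>(a, s)\<in>x. \<Union>(b, t)\<in>y. fraction R S (a \<otimes>\<^bsub>R\<^esub> b) (s \<otimes>\<^bsub>R\<^esub> t)),
     one = fraction R S \<one>\<^bsub>R\<^esub> \<one>\<^bsub>R\<^esub>,
     ring.zero = fraction R S \<zero>\<^bsub>R\<^esub> \<one>\<^bsub>R\<^esub>,
     ring.add = (\<lambda>x y. \<Union>(a, s)\<in>x. \<Union>(b, t)\<in>y.
              fraction R S (a \<otimes>\<^bsub>R\<^esub> t \<oplus>\<^bsub>R\<^esub> b \<otimes>\<^bsub>R\<^esub> s) (s \<otimes>\<^bsub>R\<^esub> t))\<rparr>"

definition to_loc :: "('a, 'b) ring_scheme \<Rightarrow> 'a set \<Rightarrow> 'a \<Rightarrow> ('a \<times> 'a) set" where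
  "to_loc R S r = fraction R S r \<one>\<^bsub>R\<^esub>"

abbreviation local_ring_at :: "('a, 'b) ring_scheme \<Rightarrow> 'a set \<Rightarrow> ('a \<times> 'a) set ring" where
  "local_ring_at R P \<equiv> localization R (carrier R - P)"

text \<open>The following two are meant for integral domains only.\<close>

abbreviation fraction_field :: "('a, 'b) ring_scheme \<Rightarrow> ('a \<times> 'a) set ring" where
  "fraction_field R \<equiv> localization R (carrier R - {\<zero>\<^bsub>R\<^esub>})"

abbreviation to_fraction_field :: "('a, 'b) ring_scheme \<Rightarrow> 'a \<Rightarrow> ('a \<times> 'a) set" where
  "to_fraction_field R \<equiv> to_loc R (carrier R - {\<zero>\<^bsub>R\<^esub>})"


section \<open>Dedekind domains\<close>

text \<open>Polynomials of \<^const>\<open>univ_poly\<close> are lists with the leading coefficient first.\<close>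

definition integral_over :: "('a, 'b) ring_scheme \<Rightarrow> 'a set \<Rightarrow> 'a \<Rightarrow> bool" where
  "integral_over K A x \<longleftrightarrow>
     (\<exists>p \<in> carrier (univ_poly K A). p \<noteq> [] \<and> hd p = \<one>\<^bsub>K\<^esub> \<and> ring.eval K p x = \<zero>\<^bsub>K\<^esub>)"

definition integrally_closed :: "('a, 'b) ring_scheme \<Rightarrow> bool" where
  "integrally_closed R \<longleftrightarrow>
     (\<forall>x \<in> carrier (fraction_field R).
        integral_over (fraction_field R) (to_fraction_field R ` carrier R) x \<longrightarrow>
        x \<in> to_fraction_field R ` carrier R)"

text \<open>Fields are not excluded here.\<close>

locale dedekind_domain = noetherian_domain R for R (structure) +
  assumes integrally_closed: "integrally_closed R"
    and nonzero_prime_maximal: "\<lbrakk>primeideal P R; P \<noteq> {\<zero>}\<rbrakk> \<Longrightarrow> maximalideal P R"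


section \<open>The ideal class group\<close>

definition fractional_ideal :: "('a, 'b) ring_scheme \<Rightarrow> ('a \<times> 'a) set set \<Rightarrow> bool" where
  "fractional_ideal R I \<longleftrightarrow>
     subgroup I (add_monoid (fraction_field R)) \<and>
     (\<forall>r\<in>carrier R. \<forall>x\<in>I. to_fraction_field R r \<otimes>\<^bsub>fraction_field R\<^esub> x \<in> I) \<and>
     (\<exists>d\<in>carrier R - {\<zero>\<^bsub>R\<^esub>}. \<forall>x\<in>I.
        to_fraction_field R d \<otimes>\<^bsub>fraction_field R\<^esub> x \<in> to_fraction_field R ` carrier R)"

definition fractional_ideal_group :: "('a, 'b) ring_scheme \<Rightarrow> ('a \<times> 'a) set set monoid" where
  "fractional_ideal_group R =
    \<lparr>carrier = {I. fractional_ideal R I \<and> I \<noteq> {\<zero>\<^bsub>fraction_field R\<^esub>}},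
     monoid.mult = ideal_prod (fraction_field R),
     one = to_fraction_field R ` carrier R\<rparr>"

definition principal_fractional_ideals :: "('a, 'b) ring_scheme \<Rightarrow> ('a \<times> 'a) set set set" where
  "principal_fractional_ideals R =
     {(\<lambda>r. to_fraction_field R r \<otimes>\<^bsub>fraction_field R\<^esub> x) ` carrier R | x.
        x \<in> carrier (fraction_field R) - {\<zero>\<^bsub>fraction_field R\<^esub>}}"

definition ideal_class_group :: "('a, 'b) ring_scheme \<Rightarrow> ('a \<times> 'a) set set set monoid" where
  "ideal_class_group R = fractional_ideal_group R Mod principal_fractional_ideals R"

definition torsion_group :: "('a, 'b) monoid_scheme \<Rightarrow> bool" where
  "torsion_group G \<longleftrightarrow> (\<forall>x\<in>carrier G. \<exists>n::nat. n > 0 \<and> x [^]\<^bsub>G\<^esub> n = \<one>\<^bsub>G\<^esub>)"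

end

theory Submission
  imports Defs
begin

text \<open>
  A nonzero element \<open>a\<close> of \<open>R\<close> lies in only finitely many maximal ideals, so its image in the product
  is invertible at all but finitely many indices. A wild prime contains all elements of finite
  support, hence cannot contain the image of \<open>a\<close>. Tame primes contract into some member of \<open>E\<close>, and
  wild primes exist by Krull's theorem because \<open>E\<close> is infinite. In the flat topology of a
  noetherian ring, \<open>V(P)\<close> is the least neighbourhood of \<open>P\<close>, so the closure of \<open>E\<close> consists of the
  primes contained in some member of \<open>E\<close>.
\<close>

section \<open>Ideals\<close>

text \<open>Krull's theorem by Zorn's lemma. Properness is expressed as
  \<open>\<one> \<notin> K\<close>, a form that survives unions of chains.\<close>

lemma (in ring) exists_maximalideal:
  assumes "ideal I R" "I \<noteq> carrier R"
  shows "\<exists>M. maximalideal M R \<and> I \<subseteq> M"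
proof -
  let ?A = "{K. ideal K R \<and> I \<subseteq> K \<and> \<one> \<notin> K}"
  have "\<one> \<notin> I"
    using assms ideal.one_imp_carrier by blast
  then have "?A \<noteq> {}"
    using assms by blast
  moreover have "\<Union>C \<in> ?A" if C: "C \<noteq> {}" "subset.chain ?A C" for C
  proof -
    have "subset.chain {K. ideal K R} C"
      using C unfolding pred_on.chain_def by blast
    then have "ideal (\<Union>C) R"
      using chain_Union_is_ideal[of C] C(1) by simp
    then show ?thesis
      using C unfolding pred_on.chain_def by blast
  qed
  ultimately have "\<exists>M\<in>?A. \<forall>L\<in>?A. M \<subseteq> L \<longrightarrow> L = M"
    by (rule subset_Zorn_nonempty)
  then obtain M where M: "M \<in> ?A" and max: "\<And>L. L \<in> ?A \<Longrightarrow> M \<subseteq> L \<Longrightarrow> L = M"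
    by auto
  have "maximalideal M R"
  proof (rule maximalidealI)
    show "carrier R \<noteq> M"
      using M by auto
    fix K assume "ideal K R" "M \<subseteq> K" "K \<subseteq> carrier R"
    then show "K = M \<or> K = carrier R"
      using max[of K] M ideal.one_imp_carrier by blast
  qed (use M in blast)
  with M show ?thesis by blast
qed

text \<open>Noetherian induction: among the ideals above \<open>I\<close> with infinitely many
  maximal ideals over them, a largest one \<open>K\<close> would be neither prime nor the whole
  ring. A product in \<open>K\<close> of two elements outside \<open>K\<close> then splits the
  maximal ideals over \<open>K\<close> into two finite families. The lemma is later applied to the
  ideal generated by one nonzero element.\<close>

lemma (in noetherian_ring) finite_maximalideals_above:
  assumes "cring R" "ideal I R"
    and "\<And>P. primeideal P R \<Longrightarrow> I \<subseteq> P \<Longrightarrow> maximalideal P R"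
  shows "finite {M. maximalideal M R \<and> I \<subseteq> M}"
proof (rule ccontr)
  interpret cring R by fact
  let ?V = "\<lambda>K. {M. maximalideal M R \<and> K \<subseteq> M}"
  let ?A = "{K. ideal K R \<and> I \<subseteq> K \<and> infinite (?V K)}"
  assume "infinite (?V I)"
  then have "?A \<noteq> {}"
    using assms by blast
  moreover have "\<Union>C \<in> ?A" if C: "C \<noteq> {}" "subset.chain ?A C" for C
  proof -
    \<comment> \<open>Having infinitely many maximal ideals above does not pass to unions in
      general, but in a noetherian ring a nonempty chain of ideals contains its own union.\<close>
    have "subset.chain {K. ideal K R} C"
      using C unfolding pred_on.chain_def by blast
    from ideal_chain_is_trivial[OF C(1) this] show ?thesis
      using C unfolding pred_on.chain_def by blast
  qed
  ultimately have "\<exists>K\<in>?A. \<forall>L\<in>?A. K \<subseteq> L \<longrightarrow> L = K"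
    by (rule subset_Zorn_nonempty)
  then obtain K where K: "K \<in> ?A" and max: "\<And>L. L \<in> ?A \<Longrightarrow> K \<subseteq> L \<Longrightarrow> L = K"
    by auto
  interpret K: ideal K R using K by blast
  \<comment> \<open>Only \<open>K\<close> itself lies above a maximal \<open>K\<close>, against the
    infinitude of \<open>?V K\<close>. So \<open>K\<close> is not maximal and, by the assumption on
    primes, not prime.\<close>
  have "M = K" if "maximalideal K R" "maximalideal M R" "K \<subseteq> M" for M
    using that maximalideal.I_maximal[of K R M] maximalideal.I_notcarr[of M R]
    by (metis additive_subgroup.a_subset ideal.axioms(1) maximalideal.axioms(1))
  then have "?V K \<subseteq> {K}" if "maximalideal K R"
    using that by blast
  then have "\<not> maximalideal K R"
    using K finite_subset by blast
  then have "\<not> primeideal K R"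
    using K assms(3) by blast
  moreover have "K \<noteq> carrier R"
  proof
    assume "K = carrier R"
    then have "?V K = {}"
      by (metis (no_types, lifting) additive_subgroup.a_subset empty_Collect_eq ideal.axioms(1)
          maximalideal.I_notcarr maximalideal.axioms(1) subset_antisym)
    then show False
      using K by (metis (mono_tags, lifting) finite.emptyI mem_Collect_eq)
  qed
  ultimately obtain x y where xy: "x \<in> carrier R" "y \<in> carrier R" "x \<otimes> y \<in> K" "x \<notin> K" "y \<notin> K"
    using K.primeidealCD[OF \<open>cring R\<close>] by blast
  \<comment> \<open>Adjoining \<open>z\<close> enlarges \<open>K\<close> strictly, so by the choice
    of \<open>K\<close> only finitely many maximal ideals contain the larger ideal.\<close>
  have fin: "finite (?V (Idl (insert z K)))" if "z \<in> carrier R" "z \<notin> K" for z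
  proof -
    have "insert z K \<subseteq> carrier R"
      using that K.a_subset by blast
    then have "ideal (Idl (insert z K)) R" "insert z K \<subseteq> Idl (insert z K)"
      by (rule genideal_ideal, rule genideal_self)
    then show ?thesis
      using max[of "Idl (insert z K)"] that K by blast
  qed
  have "?V K \<subseteq> ?V (Idl (insert x K)) \<union> ?V (Idl (insert y K))"
  proof
    fix M assume "M \<in> ?V K"
    then have M: "maximalideal M R" "K \<subseteq> M" by auto
    then have "primeideal M R"
      by (simp add: maximalideal_prime)
    then have "x \<in> M \<or> y \<in> M"
      using xy M by (meson primeideal.I_prime subsetD)
    then show "M \<in> ?V (Idl (insert x K)) \<union> ?V (Idl (insert y K))"
      using M genideal_minimal[of M "insert x K"] genideal_minimal[of M "insert y K"]
      by (auto dest: maximalideal.axioms(1))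
  qed
  then have "finite (?V K)"
    using fin[of x] fin[of y] xy by (meson finite_UnI finite_subset)
  with K show False by blast
qed

section \<open>Prime ideals, units, and contraction along ring maps\<close>

lemma SpecD_ideal: "P \<in> Spec R \<Longrightarrow> ideal P R"
  by (simp add: Spec_def primeideal.axioms(1))

lemma (in cring) maximalideal_in_Spec: "maximalideal M R \<Longrightarrow> M \<in> Spec R"
  by (simp add: Spec_def maximalideal_prime)

lemma Units_notin_Spec:
  assumes "P \<in> Spec R" "x \<in> Units R"
  shows "x \<notin> P"
proof
  interpret primeideal P R using assms by (simp add: Spec_def)
  assume "x \<in> P"
  then have "\<one>\<^bsub>R\<^esub> \<in> P"
    using assms(2) I_r_closed[of x "inv\<^bsub>R\<^esub> x"] by simp
  then show False
    using I_notcarr one_imp_carrier by blast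
qed

lemma one_notin_Spec: "P \<in> Spec R \<Longrightarrow> \<one>\<^bsub>R\<^esub> \<notin> P"
  using ideal.one_imp_carrier primeideal.I_notcarr primeideal.axioms(1) unfolding Spec_def by blast

lemma comap_in_Spec:
  assumes "f \<in> ring_hom R S" "cring R" "Q \<in> Spec S"
  shows "comap R f Q \<in> Spec R"
proof -
  \<comment> \<open>The locale \<open>ideal\<close> extends \<open>ring\<close>, so a prime of
    \<open>S\<close> already carries the ring axioms of \<open>S\<close>.\<close>
  have "ring S"
    using SpecD_ideal[OF assms(3)] by (rule ideal.axioms(2))
  then interpret ring_hom_ring R S f
    using assms by (intro ring_hom_ringI2) (auto intro: cring.axioms(1))
  show ?thesis
    using primeideal_vimage assms unfolding Spec_def comap_def by blast
qed


section \<open>The flat topology\<close>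

text \<open>Every prime contains \<zero>, so the sub-basic set of \<zero> is the whole
  spectrum.\<close>

lemma (in ring) topspace_flat_topology: "topspace (flat_topology R) = Spec R"
proof -
  have "\<zero> \<in> P" if "P \<in> Spec R" for P
    using SpecD_ideal[OF that] by (simp add: additive_subgroup.zero_closed ideal.axioms(1))
  then show ?thesis
    unfolding flat_topology_def by auto
qed

text \<open>Sub-basic sets are closed under passing to larger primes, and finite intersections and
  arbitrary unions preserve this. Hence every neighbourhood of a prime below some member of
  \<open>E\<close> meets \<open>E\<close>.\<close>

lemma openin_flat_topology_up:
  assumes "openin (flat_topology R) U" "P \<in> U" "P \<subseteq> Q" "Q \<in> Spec R"
  shows "Q \<in> U"
proof -
  have "generate_topology_on {{P \<in> Spec R. a \<in> P} | a. a \<in> carrier R} U"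
    using assms(1) unfolding flat_topology_def by (rule openin_topology_generated_by)
  then show ?thesis
    using assms(2) by induction (use assms(3,4) in auto)
qed

text \<open>Finite generation turns \<open>I \<subseteq> Q\<close> into finitely many conditions
  \<open>a \<in> Q\<close>, which gives a finite intersection of sub-basic sets. For prime
  \<open>I\<close> it is the least neighbourhood of \<open>I\<close>.\<close>

lemma (in noetherian_ring) openin_flat_topology_above:
  assumes "ideal I R"
  shows "openin (flat_topology R) {Q \<in> Spec R. I \<subseteq> Q}"
proof -
  obtain A where A: "A \<subseteq> carrier R" "finite A" "I = Idl A"
    using finetely_gen assms by blast
  have "openin (flat_topology R) {Q \<in> Spec R. A \<subseteq> Q}"
    using A(2,1)
  proof (induction A)
    case empty
    then show ?case
      using openin_topspace[of "flat_topology R"] by (simp add: topspace_flat_topology)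
  next
    case (insert a A)
    have "openin (flat_topology R) {Q \<in> Spec R. a \<in> Q}"
      unfolding flat_topology_def by (rule topology_generated_by_Basis) (use insert in blast)
    then have "openin (flat_topology R) ({Q \<in> Spec R. a \<in> Q} \<inter> {Q \<in> Spec R. A \<subseteq> Q})"
      using insert by blast
    also have "{Q \<in> Spec R. a \<in> Q} \<inter> {Q \<in> Spec R. A \<subseteq> Q} = {Q \<in> Spec R. insert a A \<subseteq> Q}"
      by auto
    finally show ?case .
  qed
  also have "{Q \<in> Spec R. A \<subseteq> Q} = {Q \<in> Spec R. I \<subseteq> Q}"
    using Idl_subset_ideal A SpecD_ideal by blast
  finally show ?thesis .
qed

lemma (in noetherian_ring) flat_closure_of:
  assumes "E \<subseteq> Spec R"
  shows "flat_topology R closure_of E = {P \<in> Spec R. \<exists>Q\<in>E. P \<subseteq> Q}"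
proof (intro subset_antisym subsetI)
  fix P assume P: "P \<in> flat_topology R closure_of E"
  then have "P \<in> Spec R"
    and meets: "\<And>U. P \<in> U \<Longrightarrow> openin (flat_topology R) U \<Longrightarrow> \<exists>Q\<in>E. Q \<in> U"
    by (auto simp: in_closure_of topspace_flat_topology)
  \<comment> \<open>Membership in the closure is tested on one open set only: the primes containing
    \<open>P\<close>.\<close>
  then show "P \<in> {P \<in> Spec R. \<exists>Q\<in>E. P \<subseteq> Q}"
    using meets[OF _ openin_flat_topology_above[OF SpecD_ideal, of P]] by blast
next
  fix P assume "P \<in> {P \<in> Spec R. \<exists>Q\<in>E. P \<subseteq> Q}"
  then obtain Q where "P \<in> Spec R" "Q \<in> E" "P \<subseteq> Q" by blast
  then show "P \<in> flat_topology R closure_of E"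
    unfolding in_closure_of topspace_flat_topology
    using assms openin_flat_topology_up[of R _ P Q] by blast
qed


section \<open>Products of rings\<close>

lemma product_ring_simps:
  "carrier (product_ring J A) = (\<Pi>\<^sub>E i\<in>J. carrier (A i))"
  "x \<otimes>\<^bsub>product_ring J A\<^esub> y = (\<lambda>i\<in>J. x i \<otimes>\<^bsub>A i\<^esub> y i)"
  "x \<oplus>\<^bsub>product_ring J A\<^esub> y = (\<lambda>i\<in>J. x i \<oplus>\<^bsub>A i\<^esub> y i)"
  "\<one>\<^bsub>product_ring J A\<^esub> = (\<lambda>i\<in>J. \<one>\<^bsub>A i\<^esub>)"
  "\<zero>\<^bsub>product_ring J A\<^esub> = (\<lambda>i\<in>J. \<zero>\<^bsub>A i\<^esub>)"
  by (simp_all add: product_ring_def)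

locale cring_family =
  fixes J :: "'i set" and A :: "'i \<Rightarrow> ('a, 'b) ring_scheme"
  assumes cring_component: "i \<in> J \<Longrightarrow> cring (A i)"
begin

lemma ring_component: "i \<in> J \<Longrightarrow> ring (A i)"
  by (simp add: cring.axioms(1) cring_component)

lemma component_closed: "x \<in> carrier (product_ring J A) \<Longrightarrow> i \<in> J \<Longrightarrow> x i \<in> carrier (A i)"
  by (auto simp: product_ring_simps)

lemma restrict_mem_product_iff:
  "(\<lambda>i\<in>J. f i) \<in> carrier (product_ring J A) \<longleftrightarrow> (\<forall>i\<in>J. f i \<in> carrier (A i))"
  by (auto simp: product_ring_simps restrict_PiE_iff)

lemma product_eqI:
  assumes "x \<in> carrier (product_ring J A)" "y \<in> carrier (product_ring J A)"
    and "\<And>i. i \<in> J \<Longrightarrow> x i = y i"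
  shows "x = y"
  using assms by (auto simp: product_ring_simps intro: PiE_ext)

text \<open>Together with \<open>product_eqI\<close>, these rules reduce an identity in the product
  to identities in the factors.\<close>

lemmas product_simps =
  product_ring_simps(2-) component_closed restrict_mem_product_iff
  cring.cring_simprules[OF cring_component] monoid.r_one[OF ring.is_monoid[OF ring_component]]

lemma cring_product_ring: "cring (product_ring J A)"
proof (rule cringI)
  show "abelian_group (product_ring J A)"
  proof (rule abelian_groupI)
    fix x assume x: "x \<in> carrier (product_ring J A)"
    show "\<exists>y\<in>carrier (product_ring J A). y \<oplus>\<^bsub>product_ring J A\<^esub> x = \<zero>\<^bsub>product_ring J A\<^esub>"
      by (rule bexI[of _ "\<lambda>i\<in>J. \<ominus>\<^bsub>A i\<^esub> x i"])
        (use x in \<open>auto simp: product_simps intro!: product_eqI\<close>)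
  qed (auto simp: product_simps intro!: product_eqI)
  show "comm_monoid (product_ring J A)"
    by (rule comm_monoidI) (auto simp: product_simps intro!: product_eqI)
qed (auto simp: product_simps intro!: product_eqI)

sublocale product: cring "product_ring J A"
  by (rule cring_product_ring)

section \<open>Projections, extension by zero, and tame primes\<close>

lemma projection_ring_hom: "k \<in> J \<Longrightarrow> (\<lambda>x. x k) \<in> ring_hom (product_ring J A) (A k)"
  by (rule ring_hom_memI) (auto simp: product_ring_simps)

text \<open>Extension by zero from one factor. It respects sums and products but in general not the
  unit: for \<open>k \<in> J\<close>, \<open>single k \<one>\<close> is the idempotent that cuts out
  the factor \<open>A k\<close>. Membership of these idempotents in a prime separates tame from
  wild.\<close>

definition single :: "'i \<Rightarrow> 'a \<Rightarrow> 'i \<Rightarrow> 'a" where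
  "single k x = (\<lambda>i\<in>J. if i = k then x else \<zero>\<^bsub>A i\<^esub>)"

lemma single_closed: "x \<in> carrier (A k) \<Longrightarrow> single k x \<in> carrier (product_ring J A)"
  by (auto simp: single_def product_simps)

lemma single_mult:
  "single k (x \<otimes>\<^bsub>A k\<^esub> y) = single k x \<otimes>\<^bsub>product_ring J A\<^esub> single k y"
  by (auto simp: single_def product_simps intro!: restrict_ext)

lemma single_add:
  "single k (x \<oplus>\<^bsub>A k\<^esub> y) = single k x \<oplus>\<^bsub>product_ring J A\<^esub> single k y"
  by (auto simp: single_def product_simps intro!: restrict_ext)

lemma single_zero: "single k \<zero>\<^bsub>A k\<^esub> = \<zero>\<^bsub>product_ring J A\<^esub>"
  by (auto simp: single_def product_simps intro!: restrict_ext)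

lemma single_one_mult:
  "x \<in> carrier (product_ring J A) \<Longrightarrow>
    single k \<one>\<^bsub>A k\<^esub> \<otimes>\<^bsub>product_ring J A\<^esub> x = single k (x k)"
  by (auto simp: single_def product_simps intro!: restrict_ext)

text \<open>Let \<open>p\<close> be the preimage of \<open>P\<close> under extension by zero. As the
  idempotent of index \<open>k\<close> is outside \<open>P\<close>, an element belongs to
  \<open>P\<close> exactly when its product with the idempotent does, that is, when its
  \<open>k\<close>-th coordinate lies in \<open>p\<close>.\<close>

lemma tame_primeI:
  assumes P: "P \<in> Spec (product_ring J A)" and k: "k \<in> J" and e: "single k \<one>\<^bsub>A k\<^esub> \<notin> P"
  shows "tame_prime J A P"
proof -
  interpret P: primeideal P "product_ring J A"
    using P by (simp add: Spec_def)
  interpret Ak: cring "A k"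
    using cring_component k .
  define p where "p = {x \<in> carrier (A k). single k x \<in> P}"
  have "primeideal p (A k)"
  proof (rule primeidealI)
    show "ideal p (A k)"
    proof (rule idealI)
      show "subgroup p (add_monoid (A k))"
      proof (rule Ak.add.subgroupI)
        show "p \<noteq> {}"
          using k by (auto simp: p_def single_zero intro!: exI[of _ "\<zero>\<^bsub>A k\<^esub>"])
        fix x assume x: "x \<in> p"
        \<comment> \<open>Negation is written as multiplication by the negative of \<one>, so that
          absorption by \<open>P\<close> applies.\<close>
        have "single k (\<ominus>\<^bsub>A k\<^esub> x) = single k (\<ominus>\<^bsub>A k\<^esub> \<one>\<^bsub>A k\<^esub>) \<otimes>\<^bsub>product_ring J A\<^esub> single k x"
          using x k by (simp add: p_def flip: single_mult) (simp add: Ak.l_minus)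
        then show "\<ominus>\<^bsub>A k\<^esub> x \<in> p"
          using x k P.I_l_closed single_closed by (simp add: p_def)
      next
        fix x y assume "x \<in> p" "y \<in> p"
        then show "x \<oplus>\<^bsub>A k\<^esub> y \<in> p"
          using k by (simp add: p_def single_add)
      qed (auto simp: p_def)
    next
      fix x a assume "x \<in> p" "a \<in> carrier (A k)"
      then show "a \<otimes>\<^bsub>A k\<^esub> x \<in> p" "x \<otimes>\<^bsub>A k\<^esub> a \<in> p"
        using k by (simp_all add: p_def single_mult single_closed P.I_l_closed P.I_r_closed)
    qed (rule Ak.ring_axioms)
    show "carrier (A k) \<noteq> p"
      using e by (auto simp: p_def)
    fix x y assume "x \<in> carrier (A k)" "y \<in> carrier (A k)" "x \<otimes>\<^bsub>A k\<^esub> y \<in> p"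
    then show "x \<in> p \<or> y \<in> p"
      using k P.I_prime[of "single k x" "single k y"] by (auto simp: p_def single_mult single_closed)
  qed (rule Ak.cring_axioms)
  \<comment> \<open>One direction is absorption by \<open>P\<close>; the other is primality, since
    the idempotent of index \<open>k\<close> is not in \<open>P\<close>.\<close>
  moreover have "x \<in> P \<longleftrightarrow> x k \<in> p" if x: "x \<in> carrier (product_ring J A)" for x
  proof -
    have "x k \<in> carrier (A k)" "single k \<one>\<^bsub>A k\<^esub> \<in> carrier (product_ring J A)"
      using x k Ak.one_closed by (auto intro: component_closed single_closed)
    then show ?thesis
      unfolding p_def using P.I_prime P.I_l_closed x e k by (auto simp flip: single_one_mult)
  qed
  then have "P = comap (product_ring J A) (\<lambda>x. x k) p"
    unfolding comap_def using P.a_subset by auto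
  ultimately show ?thesis
    using P k unfolding tame_prime_def Spec_def by blast
qed

text \<open>By \<open>tame_primeI\<close> a wild prime contains the idempotent of every index, and
  an element of finite support is a finite sum of its multiples by such idempotents.\<close>

lemma wild_prime_finite_support:
  assumes P: "wild_prime J A P" and x: "x \<in> carrier (product_ring J A)"
    and fin: "finite {i \<in> J. x i \<noteq> \<zero>\<^bsub>A i\<^esub>}"
  shows "x \<in> P"
proof -
  interpret P: primeideal P "product_ring J A"
    using P by (simp add: wild_prime_def Spec_def)
  \<comment> \<open>The induction runs over a finite set \<open>F\<close> containing the support, so
    it is irrelevant whether the removed coordinate is zero.\<close>
  have "x \<in> P" if "finite F" "x \<in> carrier (product_ring J A)" "{i \<in> J. x i \<noteq> \<zero>\<^bsub>A i\<^esub>} \<subseteq> F" "F \<subseteq> J"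
    for F x
    using that
  proof (induction F arbitrary: x)
    case empty
    then have "x = \<zero>\<^bsub>product_ring J A\<^esub>"
      by (intro product_eqI) (auto simp: product_simps)
    then show ?case by simp
  next
    case (insert k F)
    \<comment> \<open>\<open>y\<close> is \<open>x\<close> with its \<open>k\<close>-th coordinate
      erased; adding \<open>single k (x k)\<close> restores \<open>x\<close>.\<close>
    define y where "y = (\<lambda>i\<in>J. if i = k then \<zero>\<^bsub>A i\<^esub> else x i)"
    have k: "k \<in> J" using insert by simp
    have xi: "x i \<in> carrier (A i)" if "i \<in> J" for i
      using insert.prems(1) that by (rule component_closed)
    have y: "y \<in> carrier (product_ring J A)"
      using xi by (auto simp: y_def product_simps)
    have "y \<in> P"
      by (rule insert.IH[OF y]) (use insert.prems in \<open>auto simp: y_def\<close>)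
    moreover have "single k \<one>\<^bsub>A k\<^esub> \<in> P"
      using P k tame_primeI unfolding wild_prime_def by blast
    then have "single k (x k) \<in> P"
      using P.I_r_closed insert.prems(1) k by (simp flip: single_one_mult)
    ultimately have "single k (x k) \<oplus>\<^bsub>product_ring J A\<^esub> y \<in> P"
      by simp
    moreover have "single k (x k) \<oplus>\<^bsub>product_ring J A\<^esub> y = x"
      using insert.prems(1) xi
      by (intro product_eqI) (auto simp: single_def y_def product_simps)
    ultimately show ?case by simp
  qed
  from this[OF fin x] show ?thesis by blast
qed

text \<open>If \<open>x\<close> lay in \<open>P\<close>, inverting it where possible and correcting
  the finitely many other coordinates by an element of finite support would put \<one> into
  \<open>P\<close>.\<close>

lemma wild_prime_almost_unit_notin:
  assumes P: "wild_prime J A P" and x: "x \<in> carrier (product_ring J A)"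
    and fin: "finite {i \<in> J. x i \<notin> Units (A i)}"
  shows "x \<notin> P"
proof
  interpret P: primeideal P "product_ring J A"
    using P by (simp add: wild_prime_def Spec_def)
  assume "x \<in> P"
  \<comment> \<open>At indices where \<open>x\<close> is a unit, \<open>y\<close> is its inverse and
    \<open>d\<close> is \<zero>; elsewhere \<open>y\<close> is \<zero> and \<open>d\<close> is
    \<one>. Hence \<open>x\<close> times \<open>y\<close> plus \<open>d\<close> is \<one>, and
    \<open>d\<close> has finite support.\<close>
  define y where "y = (\<lambda>i\<in>J. if x i \<in> Units (A i) then inv\<^bsub>A i\<^esub> x i else \<zero>\<^bsub>A i\<^esub>)"
  define d where "d = (\<lambda>i\<in>J. if x i \<in> Units (A i) then \<zero>\<^bsub>A i\<^esub> else \<one>\<^bsub>A i\<^esub>)"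
  have monoid: "monoid (A i)" if "i \<in> J" for i
    using ring_component[OF that] by (rule ring.is_monoid)
  have y: "y \<in> carrier (product_ring J A)"
    using monoid.Units_inv_closed[OF monoid]
    by (auto simp: y_def product_simps)
  have d: "d \<in> carrier (product_ring J A)"
    by (auto simp: d_def product_simps)
  have "d \<in> P"
  proof (rule wild_prime_finite_support[OF P d])
    show "finite {i \<in> J. d i \<noteq> \<zero>\<^bsub>A i\<^esub>}"
      by (rule finite_subset[OF _ fin]) (auto simp: d_def)
  qed
  moreover have "x \<otimes>\<^bsub>product_ring J A\<^esub> y \<in> P"
    using \<open>x \<in> P\<close> y by (rule P.I_r_closed)
  ultimately have "x \<otimes>\<^bsub>product_ring J A\<^esub> y \<oplus>\<^bsub>product_ring J A\<^esub> d \<in> P"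
    by simp
  moreover have "x \<otimes>\<^bsub>product_ring J A\<^esub> y \<oplus>\<^bsub>product_ring J A\<^esub> d = \<one>\<^bsub>product_ring J A\<^esub>"
    using x monoid.Units_r_inv[OF monoid]
    by (intro product_eqI) (auto simp: y_def d_def product_simps)
  ultimately show False
    using P one_notin_Spec unfolding wild_prime_def by metis
qed

text \<open>This is the direct sum inside the product: a multiple has no larger support, and the
  support of a sum lies in the union of the supports.\<close>

lemma ideal_finite_support:
  "ideal {x \<in> carrier (product_ring J A). finite {i \<in> J. x i \<noteq> \<zero>\<^bsub>A i\<^esub>}} (product_ring J A)"
  (is "ideal ?I _")
proof (rule idealI)
  have mult: "y \<otimes>\<^bsub>product_ring J A\<^esub> x \<in> ?I" if "x \<in> ?I" "y \<in> carrier (product_ring J A)" for x y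
  proof -
    have "{i \<in> J. (y \<otimes>\<^bsub>product_ring J A\<^esub> x) i \<noteq> \<zero>\<^bsub>A i\<^esub>} \<subseteq> {i \<in> J. x i \<noteq> \<zero>\<^bsub>A i\<^esub>}"
      using that by (auto simp: product_simps)
    with that show ?thesis
      by (auto intro: finite_subset)
  qed
  then show "y \<otimes>\<^bsub>product_ring J A\<^esub> x \<in> ?I" if "x \<in> ?I" "y \<in> carrier (product_ring J A)" for x y
    using that .
  then show "x \<otimes>\<^bsub>product_ring J A\<^esub> y \<in> ?I" if "x \<in> ?I" "y \<in> carrier (product_ring J A)" for x y
    using that product.m_comm[of x y] by auto
  show "subgroup ?I (add_monoid (product_ring J A))"
  proof (rule product.add.subgroupI)
    have "{i \<in> J. \<zero>\<^bsub>product_ring J A\<^esub> i \<noteq> \<zero>\<^bsub>A i\<^esub>} = {}"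
      by (auto simp: product_ring_simps)
    then have "finite {i \<in> J. \<zero>\<^bsub>product_ring J A\<^esub> i \<noteq> \<zero>\<^bsub>A i\<^esub>}"
      by (simp only: finite.emptyI)
    then have "\<zero>\<^bsub>product_ring J A\<^esub> \<in> ?I"
      using product.zero_closed by blast
    then show "?I \<noteq> {}"
      by blast
    fix x assume "x \<in> ?I"
    then have "(\<ominus>\<^bsub>product_ring J A\<^esub> \<one>\<^bsub>product_ring J A\<^esub>) \<otimes>\<^bsub>product_ring J A\<^esub> x \<in> ?I"
      by (intro mult) simp_all
    then show "\<ominus>\<^bsub>product_ring J A\<^esub> x \<in> ?I"
      using \<open>x \<in> ?I\<close> by (simp add: product.l_minus)
  next
    fix x y assume xy: "x \<in> ?I" "y \<in> ?I"
    have "{i \<in> J. (x \<oplus>\<^bsub>product_ring J A\<^esub> y) i \<noteq> \<zero>\<^bsub>A i\<^esub>} \<subseteq>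
        {i \<in> J. x i \<noteq> \<zero>\<^bsub>A i\<^esub>} \<union> {i \<in> J. y i \<noteq> \<zero>\<^bsub>A i\<^esub>}"
      by (auto simp: product_simps)
    then show "x \<oplus>\<^bsub>product_ring J A\<^esub> y \<in> ?I"
      using xy by (auto intro: finite_subset)
  qed auto
qed (rule product.ring_axioms)

text \<open>The unit has infinite support, so the ideal of elements of finite support is proper and
  lies in a maximal ideal. That ideal contains all the idempotents \<open>single k \<one>\<close>,
  which no tame prime does.\<close>

lemma exists_wild_prime:
  assumes "infinite J" and nontriv: "\<And>i. i \<in> J \<Longrightarrow> \<one>\<^bsub>A i\<^esub> \<noteq> \<zero>\<^bsub>A i\<^esub>"
  shows "\<exists>P. wild_prime J A P"
proof -
  let ?I = "{x \<in> carrier (product_ring J A). finite {i \<in> J. x i \<noteq> \<zero>\<^bsub>A i\<^esub>}}"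
  have "{i \<in> J. \<one>\<^bsub>product_ring J A\<^esub> i \<noteq> \<zero>\<^bsub>A i\<^esub>} = J"
    using nontriv by (auto simp: product_ring_simps)
  then have "\<one>\<^bsub>product_ring J A\<^esub> \<notin> ?I"
    using \<open>infinite J\<close> by simp
  then have "?I \<noteq> carrier (product_ring J A)"
    using product.one_closed by blast
  then obtain M where M: "maximalideal M (product_ring J A)" "?I \<subseteq> M"
    using product.exists_maximalideal[OF ideal_finite_support] by blast
  have "\<not> tame_prime J A M"
  proof
    assume "tame_prime J A M"
    then obtain k p where k: "k \<in> J" "p \<in> Spec (A k)"
      and M_eq: "M = comap (product_ring J A) (\<lambda>x. x k) p"
      unfolding tame_prime_def by blast
    \<comment> \<open>The idempotent of index \<open>k\<close> has finite support, hence lies in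
      \<open>M\<close>; its \<open>k\<close>-th coordinate \<one> would then lie in the prime
      \<open>p\<close>.\<close>
    have "{i \<in> J. single k \<one>\<^bsub>A k\<^esub> i \<noteq> \<zero>\<^bsub>A i\<^esub>} \<subseteq> {k}"
      by (auto simp: single_def)
    then have "single k \<one>\<^bsub>A k\<^esub> \<in> M"
      using M(2) k single_closed[of "\<one>\<^bsub>A k\<^esub>" k] ring.ring_simprules(6)[OF ring_component] finite_subset by blast
    then have "\<one>\<^bsub>A k\<^esub> \<in> p"
      using k by (simp add: M_eq comap_def single_def)
    then show False
      using one_notin_Spec k by blast
  qed
  then show ?thesis
    using product.maximalideal_in_Spec[OF M(1)] unfolding wild_prime_def by blast
qed

end


section \<open>Localization\<close>

text \<open>Evaluates the operations of \<open>localization\<close>, which are unions over all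
  representatives: once every choice gives the same class, the union is that class. The two named
  pairs ensure that the unions are not empty.\<close>

lemma UN2_const:
  assumes "(a0, s0) \<in> L" "(b0, t0) \<in> M"
    and "\<And>a s b t. (a, s) \<in> L \<Longrightarrow> (b, t) \<in> M \<Longrightarrow> f a s b t = C"
  shows "(\<Union>(a, s)\<in>L. \<Union>(b, t)\<in>M. f a s b t) = C"
proof -
  have "(\<Union>(b, t)\<in>M. f a s b t) = C" if "(a, s) \<in> L" for a s
    by (rule SUP_eq_const) (use assms(2) assms(3)[OF that] in auto)
  then have "(case z of (a, s) \<Rightarrow> \<Union>(b, t)\<in>M. f a s b t) = C" if "z \<in> L" for z
    using that by (metis (no_types, lifting) case_prod_conv surj_pair)
  then show ?thesis
    using assms(1) by (intro SUP_eq_const) blast+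
qed

section \<open>Fractions over a multiplicative subset and their arithmetic\<close>

locale mult_subset = cring R + S: submonoid S R for S and R (structure)
begin

lemma equiv_frac_rel: "equiv (carrier R \<times> S) (frac_rel R S)"
proof (rule equivI)
  show "refl_on (carrier R \<times> S) (frac_rel R S)"
    by (rule refl_onI) (auto simp: frac_rel_def intro!: bexI[of _ \<one>])
  show "frac_rel R S \<subseteq> (carrier R \<times> S) \<times> (carrier R \<times> S)"
    by (auto simp: frac_rel_def)
  show "sym (frac_rel R S)"
  proof (rule symI)
    fix x y assume "(x, y) \<in> frac_rel R S"
    then obtain a s b t u where xy: "x = (a, s)" "y = (b, t)"
      and car: "a \<in> carrier R" "s \<in> S" "b \<in> carrier R" "t \<in> S" "u \<in> S"
      and u: "u \<otimes> (t \<otimes> a \<ominus> s \<otimes> b) = \<zero>"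
      by (auto simp: frac_rel_def)
    have "u \<otimes> (s \<otimes> b \<ominus> t \<otimes> a) = \<ominus> (u \<otimes> (t \<otimes> a \<ominus> s \<otimes> b))"
      using S.mem_carrier car by algebra
    with u car show "(y, x) \<in> frac_rel R S"
      by (auto simp: frac_rel_def xy)
  qed
  show "trans (frac_rel R S)"
  proof (rule transI)
    fix x y z assume "(x, y) \<in> frac_rel R S" "(y, z) \<in> frac_rel R S"
    then obtain a s b t c w u v where xyz: "x = (a, s)" "y = (b, t)" "z = (c, w)"
      and car: "a \<in> carrier R" "s \<in> S" "b \<in> carrier R" "t \<in> S" "c \<in> carrier R" "w \<in> S" "u \<in> S" "v \<in> S"
      and u: "u \<otimes> (t \<otimes> a \<ominus> s \<otimes> b) = \<zero>" and v: "v \<otimes> (w \<otimes> b \<ominus> t \<otimes> c) = \<zero>"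
      by (auto simp: frac_rel_def)
    \<comment> \<open>The multiplier for the composite is \<open>u \<otimes> v \<otimes> t\<close>,
      where \<open>t\<close> is the middle denominator; the terms containing \<open>b\<close> cancel
      on the right.\<close>
    have "u \<otimes> v \<otimes> t \<otimes> (w \<otimes> a \<ominus> s \<otimes> c) =
        v \<otimes> w \<otimes> (u \<otimes> (t \<otimes> a \<ominus> s \<otimes> b)) \<oplus> u \<otimes> s \<otimes> (v \<otimes> (w \<otimes> b \<ominus> t \<otimes> c))"
      using S.mem_carrier car by algebra
    also have "\<dots> = \<zero>"
      using car by (simp add: u v)
    finally show "(x, z) \<in> frac_rel R S"
      using car by (auto simp: frac_rel_def xyz intro!: bexI[of _ "u \<otimes> v \<otimes> t"])
  qed
qed

text \<open>A form of \<open>frac_rel\<close> free of subtraction, so that witnesses can be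
  multiplied and the equations substituted into one another.\<close>

lemma fraction_eq_iff:
  assumes "a \<in> carrier R" "s \<in> S" "b \<in> carrier R" "t \<in> S"
  shows "fraction R S a s = fraction R S b t \<longleftrightarrow> (\<exists>u\<in>S. u \<otimes> (t \<otimes> a) = u \<otimes> (s \<otimes> b))"
proof -
  have "u \<otimes> (t \<otimes> a \<ominus> s \<otimes> b) = \<zero> \<longleftrightarrow> u \<otimes> (t \<otimes> a) = u \<otimes> (s \<otimes> b)" if "u \<in> S" for u
  proof -
    have "u \<otimes> (t \<otimes> a \<ominus> s \<otimes> b) = u \<otimes> (t \<otimes> a) \<ominus> u \<otimes> (s \<otimes> b)"
      using that assms S.mem_carrier by algebra
    then show ?thesis
      using that assms by (simp add: r_right_minus_eq)
  qed
  then have "((a, s), (b, t)) \<in> frac_rel R S \<longleftrightarrow> (\<exists>u\<in>S. u \<otimes> (t \<otimes> a) = u \<otimes> (s \<otimes> b))"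
    using assms by (auto simp: frac_rel_def)
  then show ?thesis
    unfolding fraction_def using eq_equiv_class_iff[OF equiv_frac_rel] assms by auto
qed

lemma fraction_eqI:
  assumes "a \<in> carrier R" "s \<in> S" "b \<in> carrier R" "t \<in> S" "t \<otimes> a = s \<otimes> b"
  shows "fraction R S a s = fraction R S b t"
  using assms by (auto simp: fraction_eq_iff intro!: bexI[of _ \<one>])

lemma mem_fractionE:
  assumes "(b, t) \<in> fraction R S a s"
  obtains u where "b \<in> carrier R" "t \<in> S" "u \<in> S" "u \<otimes> (t \<otimes> a) = u \<otimes> (s \<otimes> b)"
proof -
  have 1: "((a, s), (b, t)) \<in> frac_rel R S"
    using assms by (simp add: fraction_def)
  then have car: "a \<in> carrier R" "s \<in> S" "b \<in> carrier R" "t \<in> S"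
    by (auto simp: frac_rel_def)
  have "fraction R S a s = fraction R S b t"
    unfolding fraction_def using equiv_class_eq[OF equiv_frac_rel 1] .
  then show thesis
    using that car by (auto simp: fraction_eq_iff)
qed

lemma fraction_self: "a \<in> carrier R \<Longrightarrow> s \<in> S \<Longrightarrow> (a, s) \<in> fraction R S a s"
  unfolding fraction_def using equiv_class_self[OF equiv_frac_rel] by auto

lemma carrier_localization:
  "carrier (localization R S) = {fraction R S a s | a s. a \<in> carrier R \<and> s \<in> S}"
  by (auto simp: localization_def quotient_def fraction_def)

lemma fraction_closed:
  "a \<in> carrier R \<Longrightarrow> s \<in> S \<Longrightarrow> fraction R S a s \<in> carrier (localization R S)"
  by (auto simp: carrier_localization)

lemma localizationE:
  assumes "x \<in> carrier (localization R S)"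
  obtains a s where "a \<in> carrier R" "s \<in> S" "x = fraction R S a s"
  using assms by (auto simp: carrier_localization)

text \<open>If \<open>u\<close> and \<open>v\<close> witness the two changes of representative, then
  \<open>u \<otimes> v\<close> witnesses the change of the product, so the union defining the
  product is a single class.\<close>

lemma fraction_mult:
  assumes "a \<in> carrier R" "s \<in> S" "b \<in> carrier R" "t \<in> S"
  shows "fraction R S a s \<otimes>\<^bsub>localization R S\<^esub> fraction R S b t = fraction R S (a \<otimes> b) (s \<otimes> t)"
proof -
  have "fraction R S (a' \<otimes> b') (s' \<otimes> t') = fraction R S (a \<otimes> b) (s \<otimes> t)"
    if mem: "(a', s') \<in> fraction R S a s" "(b', t') \<in> fraction R S b t" for a' s' b' t'
  proof -
    obtain u v where car: "a' \<in> carrier R" "s' \<in> S" "u \<in> S" "b' \<in> carrier R" "t' \<in> S" "v \<in> S"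
      and u: "u \<otimes> (s' \<otimes> a) = u \<otimes> (s \<otimes> a')" and v: "v \<otimes> (t' \<otimes> b) = v \<otimes> (t \<otimes> b')"
      using mem by (elim mem_fractionE)
    have "u \<otimes> v \<otimes> (s \<otimes> t \<otimes> (a' \<otimes> b')) = (u \<otimes> (s \<otimes> a')) \<otimes> (v \<otimes> (t \<otimes> b'))"
      using car assms S.mem_carrier by algebra
    also have "\<dots> = (u \<otimes> (s' \<otimes> a)) \<otimes> (v \<otimes> (t' \<otimes> b))"
      by (simp only: u v)
    also have "\<dots> = u \<otimes> v \<otimes> (s' \<otimes> t' \<otimes> (a \<otimes> b))"
      using car assms S.mem_carrier by algebra
    finally show ?thesis
      using car assms by (subst fraction_eq_iff) (auto intro!: bexI[of _ "u \<otimes> v"])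
  qed
  from UN2_const[OF fraction_self[OF assms(1,2)] fraction_self[OF assms(3,4)] this]
  show ?thesis
    by (simp add: localization_def)
qed

lemma fraction_add:
  assumes "a \<in> carrier R" "s \<in> S" "b \<in> carrier R" "t \<in> S"
  shows "fraction R S a s \<oplus>\<^bsub>localization R S\<^esub> fraction R S b t =
    fraction R S (a \<otimes> t \<oplus> b \<otimes> s) (s \<otimes> t)"
proof -
  have "fraction R S (a' \<otimes> t' \<oplus> b' \<otimes> s') (s' \<otimes> t') = fraction R S (a \<otimes> t \<oplus> b \<otimes> s) (s \<otimes> t)"
    if mem: "(a', s') \<in> fraction R S a s" "(b', t') \<in> fraction R S b t" for a' s' b' t'
  proof -
    obtain u v where car: "a' \<in> carrier R" "s' \<in> S" "u \<in> S" "b' \<in> carrier R" "t' \<in> S" "v \<in> S"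
      and u: "u \<otimes> (s' \<otimes> a) = u \<otimes> (s \<otimes> a')" and v: "v \<otimes> (t' \<otimes> b) = v \<otimes> (t \<otimes> b')"
      using mem by (elim mem_fractionE)
    \<comment> \<open>The expression is regrouped so that the left-to-right change of representative
      uses the blocks \<open>u \<otimes> (s \<otimes> a')\<close> and
      \<open>v \<otimes> (t \<otimes> b')\<close>, to which the two witness equations apply.\<close>
    have "u \<otimes> v \<otimes> (s \<otimes> t \<otimes> (a' \<otimes> t' \<oplus> b' \<otimes> s')) =
        (u \<otimes> (s \<otimes> a')) \<otimes> (v \<otimes> t \<otimes> t') \<oplus> (v \<otimes> (t \<otimes> b')) \<otimes> (u \<otimes> s \<otimes> s')"
      using car assms S.mem_carrier by algebra
    also have "\<dots> = (u \<otimes> (s' \<otimes> a)) \<otimes> (v \<otimes> t \<otimes> t') \<oplus> (v \<otimes> (t' \<otimes> b)) \<otimes> (u \<otimes> s \<otimes> s')"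
      by (simp only: u v)
    also have "\<dots> = u \<otimes> v \<otimes> (s' \<otimes> t' \<otimes> (a \<otimes> t \<oplus> b \<otimes> s))"
      using car assms S.mem_carrier by algebra
    finally show ?thesis
      using car assms by (subst fraction_eq_iff) (auto intro!: bexI[of _ "u \<otimes> v"])
  qed
  from UN2_const[OF fraction_self[OF assms(1,2)] fraction_self[OF assms(3,4)] this]
  show ?thesis
    by (simp add: localization_def)
qed

lemma localization_one: "\<one>\<^bsub>localization R S\<^esub> = fraction R S \<one> \<one>"
  and localization_zero: "\<zero>\<^bsub>localization R S\<^esub> = fraction R S \<zero> \<one>"
  by (simp_all add: localization_def)

lemmas fraction_simps =
  fraction_mult fraction_add localization_one localization_zero fraction_closed

lemma cring_localization: "cring (localization R S)"
proof (rule cringI)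
  show "abelian_group (localization R S)"
  proof (rule abelian_groupI)
    fix x y assume "x \<in> carrier (localization R S)" "y \<in> carrier (localization R S)"
    then show "x \<oplus>\<^bsub>localization R S\<^esub> y \<in> carrier (localization R S)"
      by (elim localizationE) (simp add: fraction_simps)
  next
    fix x y z
    assume "x \<in> carrier (localization R S)" "y \<in> carrier (localization R S)"
      "z \<in> carrier (localization R S)"
    then obtain a s b t c w where car: "a \<in> carrier R" "s \<in> S" "b \<in> carrier R" "t \<in> S" "c \<in> carrier R" "w \<in> S"
      and eq: "x = fraction R S a s" "y = fraction R S b t" "z = fraction R S c w"
      by (elim localizationE)
    have "(a \<otimes> t \<oplus> b \<otimes> s) \<otimes> w \<oplus> c \<otimes> (s \<otimes> t) = a \<otimes> (t \<otimes> w) \<oplus> (b \<otimes> w \<oplus> c \<otimes> t) \<otimes> s"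
      using car S.mem_carrier by algebra
    then show "x \<oplus>\<^bsub>localization R S\<^esub> y \<oplus>\<^bsub>localization R S\<^esub> z =
        x \<oplus>\<^bsub>localization R S\<^esub> (y \<oplus>\<^bsub>localization R S\<^esub> z)"
      using car by (simp add: eq fraction_simps m_assoc)
  next
    fix x y assume "x \<in> carrier (localization R S)" "y \<in> carrier (localization R S)"
    then show "x \<oplus>\<^bsub>localization R S\<^esub> y = y \<oplus>\<^bsub>localization R S\<^esub> x"
      by (elim localizationE) (simp add: fraction_simps m_comm a_comm)
  next
    fix x assume "x \<in> carrier (localization R S)"
    then obtain a s where car: "a \<in> carrier R" "s \<in> S" and eq: "x = fraction R S a s"
      by (elim localizationE)
    show "\<zero>\<^bsub>localization R S\<^esub> \<oplus>\<^bsub>localization R S\<^esub> x = x"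
      using car by (simp add: eq fraction_simps)
    \<comment> \<open>The sum has numerator \<zero> but denominator \<open>s \<otimes> s\<close>, so
      it still has to be identified with the fraction of \<zero> over \<one>.\<close>
    have "(\<ominus> a) \<otimes> s \<oplus> a \<otimes> s = \<zero>"
      using car S.mem_carrier by algebra
    then have "fraction R S (\<ominus> a) s \<oplus>\<^bsub>localization R S\<^esub> x = \<zero>\<^bsub>localization R S\<^esub>"
      using car by (simp add: eq fraction_simps) (rule fraction_eqI; simp)
    then show "\<exists>y\<in>carrier (localization R S). y \<oplus>\<^bsub>localization R S\<^esub> x = \<zero>\<^bsub>localization R S\<^esub>"
      by (rule bexI) (use car in \<open>simp add: fraction_closed\<close>)
  qed (simp add: fraction_simps)
  show "comm_monoid (localization R S)"
  proof (rule comm_monoidI)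
    fix x y assume "x \<in> carrier (localization R S)" "y \<in> carrier (localization R S)"
    then show "x \<otimes>\<^bsub>localization R S\<^esub> y \<in> carrier (localization R S)"
      "x \<otimes>\<^bsub>localization R S\<^esub> y = y \<otimes>\<^bsub>localization R S\<^esub> x"
      by (elim localizationE; simp add: fraction_simps m_comm)+
  next
    fix x y z
    assume "x \<in> carrier (localization R S)" "y \<in> carrier (localization R S)"
      "z \<in> carrier (localization R S)"
    then show "x \<otimes>\<^bsub>localization R S\<^esub> y \<otimes>\<^bsub>localization R S\<^esub> z =
        x \<otimes>\<^bsub>localization R S\<^esub> (y \<otimes>\<^bsub>localization R S\<^esub> z)"
      by (elim localizationE) (simp add: fraction_simps m_assoc)
  next
    fix x assume "x \<in> carrier (localization R S)"
    then show "\<one>\<^bsub>localization R S\<^esub> \<otimes>\<^bsub>localization R S\<^esub> x = x"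
      by (elim localizationE) (simp add: fraction_simps)
  qed (simp add: fraction_simps)
  fix x y z
  assume "x \<in> carrier (localization R S)" "y \<in> carrier (localization R S)"
    "z \<in> carrier (localization R S)"
  then obtain a s b t c w where car: "a \<in> carrier R" "s \<in> S" "b \<in> carrier R" "t \<in> S" "c \<in> carrier R" "w \<in> S"
    and eq: "x = fraction R S a s" "y = fraction R S b t" "z = fraction R S c w"
    by (elim localizationE)
  \<comment> \<open>The two sides of distributivity have different denominators, the right one with
    an extra factor \<open>w\<close>; this is the cross-multiplied identity.\<close>
  have "(s \<otimes> w \<otimes> (t \<otimes> w)) \<otimes> ((a \<otimes> t \<oplus> b \<otimes> s) \<otimes> c) =
      (s \<otimes> t \<otimes> w) \<otimes> (a \<otimes> c \<otimes> (t \<otimes> w) \<oplus> b \<otimes> c \<otimes> (s \<otimes> w))"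
    using car S.mem_carrier by algebra
  then show "(x \<oplus>\<^bsub>localization R S\<^esub> y) \<otimes>\<^bsub>localization R S\<^esub> z =
      x \<otimes>\<^bsub>localization R S\<^esub> z \<oplus>\<^bsub>localization R S\<^esub> y \<otimes>\<^bsub>localization R S\<^esub> z"
    using car by (simp add: eq fraction_simps) (rule fraction_eqI; simp)
qed

sublocale loc: cring "localization R S"
  by (rule cring_localization)

section \<open>The canonical map to the localization and the primes it reaches\<close>

lemma to_loc_ring_hom: "to_loc R S \<in> ring_hom R (localization R S)"
  by (rule ring_hom_memI) (simp_all add: to_loc_def fraction_simps)

lemma to_loc_unit:
  assumes "s \<in> S"
  shows "to_loc R S s \<in> Units (localization R S)"
proof -
  have "fraction R S \<one> s \<otimes>\<^bsub>localization R S\<^esub> to_loc R S s = \<one>\<^bsub>localization R S\<^esub>"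
    "to_loc R S s \<otimes>\<^bsub>localization R S\<^esub> fraction R S \<one> s = \<one>\<^bsub>localization R S\<^esub>"
    using assms by (simp_all add: to_loc_def fraction_simps) (rule fraction_eqI; simp)+
  moreover have "to_loc R S s \<in> carrier (localization R S)"
    "fraction R S \<one> s \<in> carrier (localization R S)"
    using assms by (simp_all add: to_loc_def fraction_closed)
  ultimately show ?thesis
    unfolding Units_def by blast
qed

text \<open>The prime above \<open>Q\<close> is its extension, the fractions with numerator in
  \<open>Q\<close>. Disjointness from \<open>S\<close> makes it proper and makes it contract back to
  \<open>Q\<close>.\<close>

lemma Spec_in_image_comap_to_loc:
  assumes Q: "Q \<in> Spec R" and disj: "Q \<inter> S = {}"
  shows "Q \<in> comap R (to_loc R S) ` Spec (localization R S)"
proof -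
  interpret Q: primeideal Q R
    using Q by (simp add: Spec_def)
  define L where "L = {fraction R S a s | a s. a \<in> Q \<and> s \<in> S}"
  \<comment> \<open>Membership does not depend on the representative:
    \<open>u \<otimes> t \<otimes> a\<close> lies in \<open>Q\<close>, while
    \<open>u \<otimes> t\<close> lies in \<open>S\<close> and hence outside the prime
    \<open>Q\<close>.\<close>
  have mem: "fraction R S a s \<in> L \<longleftrightarrow> a \<in> Q" if as: "a \<in> carrier R" "s \<in> S" for a s
  proof
    assume "fraction R S a s \<in> L"
    then obtain b t where b: "b \<in> Q" "t \<in> S" "fraction R S a s = fraction R S b t"
      by (auto simp: L_def)
    then obtain u where u: "u \<in> S" "u \<otimes> (t \<otimes> a) = u \<otimes> (s \<otimes> b)"
      using as by (auto simp: fraction_eq_iff Q.Icarr)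
    have "u \<otimes> (s \<otimes> b) \<in> Q"
      using u as b by (simp add: Q.I_l_closed)
    then have "u \<otimes> t \<otimes> a \<in> Q"
      using u as b by (simp add: m_assoc)
    moreover have "u \<otimes> t \<notin> Q"
      using u b disj by (metis S.m_closed disjoint_iff)
    ultimately show "a \<in> Q"
      using Q.I_prime u b as by (meson S.m_closed S.mem_carrier)
  qed (use as in \<open>auto simp: L_def\<close>)
  have L_sub: "x \<in> carrier (localization R S)" if "x \<in> L" for x
    using that by (auto simp: L_def fraction_closed Q.Icarr)
  have "primeideal L (localization R S)"
  proof (rule primeidealI)
    have mult: "y \<otimes>\<^bsub>localization R S\<^esub> x \<in> L" if "x \<in> L" "y \<in> carrier (localization R S)" for x y
    proof -
      obtain a s where "a \<in> Q" "s \<in> S" "x = fraction R S a s"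
        using \<open>x \<in> L\<close> by (auto simp: L_def)
      moreover obtain b t where "b \<in> carrier R" "t \<in> S" "y = fraction R S b t"
        using \<open>y \<in> carrier (localization R S)\<close> by (rule localizationE)
      ultimately show ?thesis
        by (simp add: fraction_simps Q.Icarr mem Q.I_l_closed)
    qed
    show "ideal L (localization R S)"
    proof (rule idealI)
      show "subgroup L (add_monoid (localization R S))"
      proof (rule loc.add.subgroupI)
        show "L \<noteq> {}"
          using Q.zero_closed S.one_closed unfolding L_def by blast
        fix x assume "x \<in> L"
        then have "(\<ominus>\<^bsub>localization R S\<^esub> \<one>\<^bsub>localization R S\<^esub>) \<otimes>\<^bsub>localization R S\<^esub> x \<in> L"
          by (intro mult) simp_all
        then show "\<ominus>\<^bsub>localization R S\<^esub> x \<in> L"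
          using \<open>x \<in> L\<close> L_sub by (simp add: loc.l_minus)
      next
        fix x y assume "x \<in> L" "y \<in> L"
        then obtain a s b t where "a \<in> Q" "s \<in> S" "b \<in> Q" "t \<in> S"
          "x = fraction R S a s" "y = fraction R S b t"
          by (auto simp: L_def)
        then show "x \<oplus>\<^bsub>localization R S\<^esub> y \<in> L"
          by (simp add: fraction_simps Q.Icarr mem Q.I_r_closed)
      qed (auto dest: L_sub)
      show "y \<otimes>\<^bsub>localization R S\<^esub> x \<in> L" if "x \<in> L" "y \<in> carrier (localization R S)" for x y
        using that by (rule mult)
      then show "x \<otimes>\<^bsub>localization R S\<^esub> y \<in> L" if "x \<in> L" "y \<in> carrier (localization R S)" for x y
        using that loc.m_comm L_sub by metis
    qed (rule loc.ring_axioms)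
    have "\<one>\<^bsub>localization R S\<^esub> \<notin> L"
      using mem[of \<one> \<one>] one_notin_Spec[OF Q] by (simp add: localization_one)
    then show "carrier (localization R S) \<noteq> L"
      using loc.one_closed by blast
    fix x y assume "x \<in> carrier (localization R S)" "y \<in> carrier (localization R S)"
      "x \<otimes>\<^bsub>localization R S\<^esub> y \<in> L"
    then show "x \<in> L \<or> y \<in> L"
      by (elim localizationE) (use Q.I_prime in \<open>simp add: fraction_simps mem\<close>)
  qed (rule cring_localization)
  moreover have "comap R (to_loc R S) L = Q"
    using mem Q.a_subset by (auto simp: comap_def to_loc_def)
  ultimately show ?thesis
    unfolding Spec_def by blast
qed

end

lemma (in cring) mult_subset_complement:
  assumes "P \<in> Spec R"
  shows "mult_subset (carrier R - P) R"
proof -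
  interpret P: primeideal P R using assms by (simp add: Spec_def)
  show ?thesis
    by unfold_locales (use P.I_prime one_notin_Spec[OF assms] in auto)
qed


section \<open>Spectra of products over maximal ideals\<close>

text \<open>Treats residue fields and localizations together through what they share: each
  \<open>\<phi> p\<close> sends elements outside \<open>p\<close> to units, and \<open>p\<close> is
  a contraction along it. Tame primes then contract to \<zero> or a member of \<open>E\<close>, and
  wild primes, which exist, contract to \<zero>.\<close>

lemma comap_product_over_maximalideals:
  fixes R :: "('a, 'b) ring_scheme" and A :: "'a set \<Rightarrow> ('c, 'd) ring_scheme"
  defines "\<pi> \<equiv> \<lambda>\<phi> E r. \<lambda>p\<in>E. \<phi> p r"
  assumes R: "noetherian_domain R"
    and dim: "\<And>P. primeideal P R \<Longrightarrow> P \<noteq> {\<zero>\<^bsub>R\<^esub>} \<Longrightarrow> maximalideal P R"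
    and E: "E \<subseteq> {M. maximalideal M R}" "infinite E"
    and A: "\<And>p. p \<in> E \<Longrightarrow> cring (A p)"
    and hom: "\<And>p. p \<in> E \<Longrightarrow> \<phi> p \<in> ring_hom R (A p)"
    and units: "\<And>p r. p \<in> E \<Longrightarrow> r \<in> carrier R - p \<Longrightarrow> \<phi> p r \<in> Units (A p)"
    and surj: "\<And>p. p \<in> E \<Longrightarrow> p \<in> comap R (\<phi> p) ` Spec (A p)"
  shows "comap R (\<pi> \<phi> E) ` Spec (product_ring E A) = E \<union> {{\<zero>\<^bsub>R\<^esub>}}" (is ?image)
    and "wild_prime E A P \<Longrightarrow> comap R (\<pi> \<phi> E) P = {\<zero>\<^bsub>R\<^esub>}"
proof -
  interpret R: noetherian_domain R by fact
  interpret cring_family E A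
    by (rule cring_family.intro) (rule A)
  let ?\<pi> = "\<pi> \<phi> E" and ?S = "product_ring E A"
  have \<pi>_hom: "?\<pi> \<in> ring_hom R ?S"
    by (rule ring_hom_memI)
      (auto simp: \<pi>_def product_ring_simps ring_hom_closed[OF hom] ring_hom_mult[OF hom]
        ring_hom_add[OF hom] ring_hom_one[OF hom] intro!: restrict_ext)
  \<comment> \<open>The canonical map followed by the projection to index \<open>p\<close> is
    \<open>\<phi> p\<close>.\<close>
  have comap_comp: "comap R ?\<pi> (comap ?S (\<lambda>x. x p) q) = comap R (\<phi> p) q" if "p \<in> E" for p q
    using that ring_hom_closed[OF \<pi>_hom] by (auto simp: comap_def) (simp_all add: \<pi>_def)
  have zero_in: "\<zero>\<^bsub>R\<^esub> \<in> Q" if "Q \<in> Spec R" for Q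
    using SpecD_ideal[OF that] by (simp add: additive_subgroup.zero_closed ideal.axioms(1))
  show wild: "comap R ?\<pi> P = {\<zero>\<^bsub>R\<^esub>}" if P: "wild_prime E A P" for P
  proof -
    have "\<zero>\<^bsub>R\<^esub> \<in> comap R ?\<pi> P"
      using P comap_in_Spec[OF \<pi>_hom R.cring_axioms] zero_in unfolding wild_prime_def by blast
    moreover have "a = \<zero>\<^bsub>R\<^esub>" if a: "a \<in> comap R ?\<pi> P" for a
    proof (rule ccontr)
      assume nz: "a \<noteq> \<zero>\<^bsub>R\<^esub>"
      have a_car: "a \<in> carrier R" and "?\<pi> a \<in> P"
        using a by (auto simp: comap_def)
      \<comment> \<open>Primes above this nonzero ideal are nonzero, hence maximal, so only finitely
        many maximal ideals contain \<open>a\<close>. These include every index at which the image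
        of \<open>a\<close> fails to be a unit.\<close>
      let ?I = "genideal R {a}"
      have "a \<in> ?I"
        using a_car by (rule R.genideal_self')
      then have "finite {M. maximalideal M R \<and> ?I \<subseteq> M}"
        using dim nz a_car
        by (intro R.finite_maximalideals_above R.cring_axioms R.genideal_ideal) auto
      moreover have "{p \<in> E. ?\<pi> a p \<notin> Units (A p)} \<subseteq> {M. maximalideal M R \<and> ?I \<subseteq> M}"
      proof
        fix p assume p: "p \<in> {p \<in> E. ?\<pi> a p \<notin> Units (A p)}"
        then have "\<phi> p a \<notin> Units (A p)"
          by (auto simp: \<pi>_def)
        then have "a \<in> p"
          using units[of p a] a_car p by blast
        moreover have "maximalideal p R"
          using p E by blast
        ultimately show "p \<in> {M. maximalideal M R \<and> ?I \<subseteq> M}"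
          using R.genideal_minimal[of p "{a}"] maximalideal.axioms(1) by auto
      qed
      ultimately have "?\<pi> a \<notin> P"
        using wild_prime_almost_unit_notin[OF P ring_hom_closed[OF \<pi>_hom a_car]] finite_subset
        by blast
      with \<open>?\<pi> a \<in> P\<close> show False by simp
    qed
    ultimately show ?thesis by blast
  qed
  show ?image
  proof (intro subset_antisym subsetI)
    fix Q assume "Q \<in> comap R ?\<pi> ` Spec ?S"
    then obtain P where P: "P \<in> Spec ?S" "Q = comap R ?\<pi> P" by blast
    show "Q \<in> E \<union> {{\<zero>\<^bsub>R\<^esub>}}"
    proof (cases "tame_prime E A P")
      case True
      then obtain p q where p: "p \<in> E" "q \<in> Spec (A p)" "Q = comap R (\<phi> p) q"
        using P(2) comap_comp unfolding tame_prime_def by blast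
      have "Q \<in> Spec R"
        unfolding p(3) by (rule comap_in_Spec[OF hom[OF p(1)] R.cring_axioms p(2)])
      \<comment> \<open>Elements outside \<open>p\<close> become units and so avoid
        \<open>q\<close>. As nonzero primes are maximal, only \<zero> and \<open>p\<close> remain
        for \<open>Q\<close>.\<close>
      moreover have "Q \<subseteq> p"
        using Units_notin_Spec[OF p(2)] units[OF p(1)] by (auto simp: p(3) comap_def)
      moreover have "maximalideal p R"
        using p E by blast
      ultimately have "Q = {\<zero>\<^bsub>R\<^esub>} \<or> Q = p"
        using dim[of Q] maximalideal.I_maximal[of Q R p] maximalideal.I_notcarr[of p R]
          maximalideal.axioms(1)[of p R] ideal.axioms(1) additive_subgroup.a_subset
        unfolding Spec_def by blast
      then show ?thesis
        using p(1) by blast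
    next
      case False
      then show ?thesis
        using wild P unfolding wild_prime_def by blast
    qed
  next
    fix Q assume Q: "Q \<in> E \<union> {{\<zero>\<^bsub>R\<^esub>}}"
    show "Q \<in> comap R ?\<pi> ` Spec ?S"
    proof (cases "Q \<in> E")
      case True
      then obtain q where q: "q \<in> Spec (A Q)" "Q = comap R (\<phi> Q) q"
        using surj by blast
      have "comap ?S (\<lambda>x. x Q) q \<in> Spec ?S"
        by (rule comap_in_Spec[OF projection_ring_hom[OF True] cring_product_ring q(1)])
      then show ?thesis
        using comap_comp[OF True] q(2) by blast
    next
      case False
      \<comment> \<open>Here \<open>Q\<close> is the zero ideal, reached from any wild prime. To
        obtain one, the factors must be nontrivial, which holds because each has a prime.\<close>
      have "\<one>\<^bsub>A p\<^esub> \<noteq> \<zero>\<^bsub>A p\<^esub>" if "p \<in> E" for p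
      proof -
        obtain q where "q \<in> Spec (A p)"
          using surj[OF \<open>p \<in> E\<close>] by blast
        then show ?thesis
          using one_notin_Spec[of q] SpecD_ideal[of q]
          by (metis additive_subgroup.zero_closed ideal.axioms(1))
      qed
      then obtain P where "wild_prime E A P"
        using exists_wild_prime E(2) by blast
      then show ?thesis
        using wild False Q unfolding wild_prime_def by blast
    qed
  qed
qed


theorem theorem3p10:
  fixes R :: "('a, 'b) ring_scheme" and E :: "'a set set"
  assumes "dedekind_domain R"
    and "torsion_group (ideal_class_group R)"
    and "E \<subseteq> {M. maximalideal M R}"
    and "infinite E"
  shows
    "(let A = (\<lambda>p. R Quot p);
          S = product_ring E A;
          \<pi> = (\<lambda>r. \<lambda>p\<in>E. p +>\<^bsub>R\<^esub> r)
      in comap R \<pi> ` Spec S = E \<union> {{\<zero>\<^bsub>R\<^esub>}} \<and>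
         (\<forall>P. wild_prime E A P \<longrightarrow> comap R \<pi> P = {\<zero>\<^bsub>R\<^esub>})) \<and>
     (let A = (\<lambda>p. local_ring_at R p);
          S = product_ring E A;
          \<pi> = (\<lambda>r. \<lambda>p\<in>E. to_loc R (carrier R - p) r)
      in comap R \<pi> ` Spec S = flat_topology R closure_of E \<and>
         flat_topology R closure_of E = E \<union> {{\<zero>\<^bsub>R\<^esub>}} \<and>
         (\<forall>P. wild_prime E A P \<longrightarrow> comap R \<pi> P = {\<zero>\<^bsub>R\<^esub>}))"
proof -
  interpret R: dedekind_domain R by fact
  have max: "maximalideal p R" if "p \<in> E" for p
    using assms(3) that by blast
  have E_Spec: "E \<subseteq> Spec R"
    using max R.maximalideal_in_Spec by blast
  note key = comap_product_over_maximalideals[OF R.noetherian_domain_axioms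
      R.nonzero_prime_maximal assms(3,4)]

  \<comment> \<open>In the residue field, elements outside \<open>p\<close> become nonzero, hence
    units, and \<open>p\<close> is the contraction of the zero ideal.\<close>
  have quot: "cring (R Quot p)" "(+>\<^bsub>R\<^esub>) p \<in> ring_hom R (R Quot p)"
    "\<And>r. r \<in> carrier R - p \<Longrightarrow> p +>\<^bsub>R\<^esub> r \<in> Units (R Quot p)"
    "p \<in> comap R ((+>\<^bsub>R\<^esub>) p) ` Spec (R Quot p)" if p: "p \<in> E" for p
  proof -
    interpret p: maximalideal p R using max[OF p] .
    show hom: "(+>\<^bsub>R\<^esub>) p \<in> ring_hom R (R Quot p)"
      by (rule p.rcos_ring_hom)
    interpret Q: field "R Quot p"
      using p.quotient_is_field R.cring_axioms .
    show "cring (R Quot p)" by (rule Q.cring_axioms)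
    have zero_iff: "p +>\<^bsub>R\<^esub> r = \<zero>\<^bsub>R Quot p\<^esub> \<longleftrightarrow> r \<in> p" if "r \<in> carrier R" for r
      using that p.rcos_const_imp_mem p.a_rcos_const by (auto simp: FactRing_def)
    show "p +>\<^bsub>R\<^esub> r \<in> Units (R Quot p)" if "r \<in> carrier R - p" for r
      using that zero_iff[of r] ring_hom_closed[OF hom, of r] by (simp add: Q.field_Units)
    have "comap R ((+>\<^bsub>R\<^esub>) p) {\<zero>\<^bsub>R Quot p\<^esub>} = p"
      using zero_iff p.a_subset by (auto simp: comap_def)
    moreover have "{\<zero>\<^bsub>R Quot p\<^esub>} \<in> Spec (R Quot p)"
      using Q.zeroprimeideal by (simp add: Spec_def)
    ultimately show "p \<in> comap R ((+>\<^bsub>R\<^esub>) p) ` Spec (R Quot p)"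
      by blast
  qed

  \<comment> \<open>In the localization, elements outside \<open>p\<close> are invertible as
    denominators, and \<open>p\<close> is a contraction because it is disjoint from them.\<close>
  have loc: "cring (local_ring_at R p)" "to_loc R (carrier R - p) \<in> ring_hom R (local_ring_at R p)"
    "\<And>r. r \<in> carrier R - p \<Longrightarrow> to_loc R (carrier R - p) r \<in> Units (local_ring_at R p)"
    "p \<in> comap R (to_loc R (carrier R - p)) ` Spec (local_ring_at R p)" if p: "p \<in> E" for p
  proof -
    have p': "p \<in> Spec R"
      using E_Spec p by blast
    interpret mult_subset "carrier R - p" R
      using p' by (rule R.mult_subset_complement)
    show "cring (local_ring_at R p)" "to_loc R (carrier R - p) \<in> ring_hom R (local_ring_at R p)"
      "\<And>r. r \<in> carrier R - p \<Longrightarrow> to_loc R (carrier R - p) r \<in> Units (local_ring_at R p)"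
      by (rule cring_localization to_loc_ring_hom to_loc_unit, assumption?)+
    show "p \<in> comap R (to_loc R (carrier R - p)) ` Spec (local_ring_at R p)"
      using p' by (intro Spec_in_image_comap_to_loc) auto
  qed

  \<comment> \<open>The closure consists of the primes below members of \<open>E\<close>; a nonzero
    such prime is maximal and therefore equals the member above it.\<close>
  have "P \<in> E \<union> {{\<zero>\<^bsub>R\<^esub>}}" if "P \<in> Spec R" "Q \<in> E" "P \<subseteq> Q" for P Q
    using that R.nonzero_prime_maximal[of P] max[of Q]
      maximalideal.I_maximal[of P R Q] maximalideal.I_notcarr[of Q R]
      maximalideal.axioms(1)[of Q R] ideal.axioms(1) additive_subgroup.a_subset
    unfolding Spec_def by blast
  \<comment> \<open>An infinite \<open>E\<close> is nonempty, and the zero ideal lies below each of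
    its members, hence in the closure.\<close>
  moreover have "\<exists>Q\<in>E. {\<zero>\<^bsub>R\<^esub>} \<subseteq> Q"
  proof -
    obtain Q where "Q \<in> E"
      using assms(4) by fastforce
    then show ?thesis
      using max[of Q] maximalideal.axioms(1) ideal.axioms(1) additive_subgroup.zero_closed by blast
  qed
  moreover have "{\<zero>\<^bsub>R\<^esub>} \<in> Spec R"
    using R.zeroprimeideal by (simp add: Spec_def)
  ultimately have closure: "flat_topology R closure_of E = E \<union> {{\<zero>\<^bsub>R\<^esub>}}"
    unfolding R.flat_closure_of[OF E_Spec] using E_Spec by blast

  show ?thesis
    unfolding Let_def closure
    using key[of "\<lambda>p. R Quot p" "\<lambda>p. (+>\<^bsub>R\<^esub>) p", OF _ _ quot]
      key[of "\<lambda>p. local_ring_at R p" "\<lambda>p. to_loc R (carrier R - p)", OF _ _ loc]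
    by simp
qed

end
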